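(* Let $a<b$ be real numbers, let $q\in(0,1)$, and let $f:[a,b]\to\mathbb{R}$ be a $q$-integrable function over $[a,b]$. Then $$\left| f\left(a+q^{\left\lfloor \log_q\frac12\right\rfloor}(b-a)\right)-\frac{1}{b-a}\int_a^b f(t)\,d_q^a t\right| \le (b-a)\left(\frac{1+2q^{2\left\lfloor \log_q\frac12\right\rfloor+1}}{1+q}-q^{\left\lfloor \log_q\frac12\right\rfloor}\right)\left\|D_q^a f\right\|_\infty^{(a,b]}.$$
   Context: Let $f:[a,b]\to\mathbb{R}$ and $q\in(0,1)$. The (shifted) $q$-derivative of $f$ at $x\in(a,b]$ is $$D_q^a f(x)=\frac{f(x)-f(a+q(x-a))}{(1-q)(x-a)}.$$ The (shifted) $q$-integral is $$\int_a^b f(t)\,d_q^a t=(1-q)(b-a)\sum_{k=0}^\infty q^k f\big(a+q^k(b-a)\big),$$ and $f$ is called $q$-integrable over $[a,b]$ if this series converges. For a function $g$ defined on $(a,b]$, $\|g\|_\infty^{(a,b]}=\sup_{t\in(a,b]}|g(t)|\in[0,+\infty]$; if this is $+\infty$ the inequality is understood to hold trivially. Here $\log_q$ is the logarithm to base $q$ and $\lfloor\cdot\rfloor$ is the floor function. *)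

theory Defs
  imports Complex_Main "HOL-Library.Extended_Real"
begin

text \<open>A function on \<open>[a,b]\<close> is represented by a total function \<open>real \<Rightarrow> real\<close>; for \<open>0 < q < 1\<close> and
  \<open>a < b\<close> the notions below, taken over \<open>[a,b]\<close>, only use its values at points of \<open>[a,b]\<close>.\<close>

definition q_deriv :: "real \<Rightarrow> real \<Rightarrow> (real \<Rightarrow> real) \<Rightarrow> real \<Rightarrow> real" where
  "q_deriv q a f x = (f x - f (a + q * (x - a))) / ((1 - q) * (x - a))"

definition q_integrable :: "real \<Rightarrow> real \<Rightarrow> real \<Rightarrow> (real \<Rightarrow> real) \<Rightarrow> bool" where
  "q_integrable q a b f \<longleftrightarrow> summable (\<lambda>k. q ^ k * f (a + q ^ k * (b - a)))"

definition q_integral :: "real \<Rightarrow> real \<Rightarrow> real \<Rightarrow> (real \<Rightarrow> real) \<Rightarrow> real" where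
  "q_integral q a b f = (1 - q) * (b - a) * (\<Sum>k. q ^ k * f (a + q ^ k * (b - a)))"

text \<open>The supremum norm is extended-real valued, so that it is \<open>\<infinity>\<close> for unbounded functions.\<close>

definition sup_norm_on :: "real set \<Rightarrow> (real \<Rightarrow> real) \<Rightarrow> ereal" where
  "sup_norm_on A g = (SUP t\<in>A. ereal \<bar>g t\<bar>)"

end

theory Submission
  imports Defs
begin

text \<open>Along the nodes \<open>a + q\<^sup>k (b - a)\<close> a bound \<open>M\<close> on the \<open>q\<close>-derivative telescopes to a Lipschitz
  estimate with constant \<open>M\<close>. The \<open>q\<close>-mean is the average of the values at the nodes with weights
  \<open>(1 - q) q\<^sup>k\<close>, so it differs from the value at the \<open>m\<close>-th node by at most \<open>M (b - a)\<close> times the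
  weighted average of \<open>\<bar>q\<^sup>k - q\<^sup>m\<bar>\<close>, which is the constant in the theorem. This works for every natural
  number \<open>m\<close>.\<close>

text \<open>With the sign fixed as \<open>q ^ m - q ^ k\<close>, the series is a difference of two
  geometric series. That sign is correct for \<open>k \<ge> m\<close>; each of the finitely many
  terms with \<open>k < m\<close> is repaired by adding twice its negative.\<close>

lemma sums_abs_diff_power:
  fixes q :: real
  assumes "0 < q" "q < 1"
  shows "(\<lambda>k. (1 - q) * q ^ k * \<bar>q ^ k - q ^ m\<bar>) sums
    ((1 + 2 * q ^ (2 * m + 1)) / (1 + q) - q ^ m)"
proof -
  have q2: "q ^ 2 < 1" using assms by (simp add: power_less_one_iff)
  have geo: "(\<lambda>k. q ^ k) sums (1 / (1 - q))" "(\<lambda>k. (q ^ 2) ^ k) sums (1 / (1 - q ^ 2))"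
    using assms q2 by (auto intro!: geometric_sums)
  have neq: "q \<noteq> 1" "q ^ 2 \<noteq> 1" using assms q2 by auto
  have "(\<lambda>k. (1 - q) * (q ^ m * q ^ k - (q ^ 2) ^ k)
      + (if k \<in> {..<m} then 2 * (1 - q) * ((q ^ 2) ^ k - q ^ m * q ^ k) else 0)) sums
    ((1 - q) * (q ^ m * (1 / (1 - q)) - 1 / (1 - q ^ 2))
      + (\<Sum>k<m. 2 * (1 - q) * ((q ^ 2) ^ k - q ^ m * q ^ k)))"
    by (intro sums_add sums_mult sums_diff geo sums_If_finite_set) auto
  also have "(\<lambda>k. (1 - q) * (q ^ m * q ^ k - (q ^ 2) ^ k)
      + (if k \<in> {..<m} then 2 * (1 - q) * ((q ^ 2) ^ k - q ^ m * q ^ k) else 0))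
    = (\<lambda>k. (1 - q) * q ^ k * \<bar>q ^ k - q ^ m\<bar>)" (is "?l = ?r")
  proof
    fix k
    have sq: "(q ^ 2) ^ k = q ^ k * q ^ k" by (simp add: power2_eq_square power_mult_distrib)
    show "?l k = ?r k"
    proof (cases "k < m")
      case True
      then have "q ^ m \<le> q ^ k" using assms by (intro power_decreasing) auto
      with True show ?thesis by (simp add: sq algebra_simps)
    next
      case False
      then have "q ^ k \<le> q ^ m" using assms by (intro power_decreasing) auto
      with False show ?thesis by (simp add: sq algebra_simps)
    qed
  qed
  also have "(\<Sum>k<m. 2 * (1 - q) * ((q ^ 2) ^ k - q ^ m * q ^ k))
    = 2 * (1 - q) * ((1 - (q ^ 2) ^ m) / (1 - q ^ 2) - q ^ m * ((1 - q ^ m) / (1 - q)))"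
    using neq by (simp add: sum_distrib_left[symmetric] sum_subtractf sum_gp_strict)
  \<comment> \<open>Once \<open>1 - q ^ 2\<close> is factored and all powers are written through
    \<open>q ^ m\<close>, this is an identity of rational functions in \<open>q\<close> and
    \<open>q ^ m\<close>.\<close>
  also have "(1 - q) * (q ^ m * (1 / (1 - q)) - 1 / (1 - q ^ 2)) + \<dots>
    = (1 + 2 * q ^ (2 * m + 1)) / (1 + q) - q ^ m"
  proof -
    have f: "1 - q ^ 2 = (1 - q) * (1 + q)" by (simp add: power2_eq_square algebra_simps)
    have p: "(q ^ 2) ^ m = q ^ m * q ^ m" "q ^ (2 * m + 1) = q * (q ^ m * q ^ m)"
      by (simp_all add: power2_eq_square power_mult_distrib mult_2 power_add)
    show ?thesis unfolding f p
      using assms by (simp add: divide_simps) (simp add: algebra_simps)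
  qed
  finally show ?thesis .
qed

text \<open>The step bounds are added up from the smaller index to the larger one by the triangle
  inequality, and their right-hand sides telescope. The order of \<open>k\<close> and
  \<open>m\<close> then decides the sign inside the absolute value.\<close>

lemma abs_diff_le_power_diff:
  fixes F :: "nat \<Rightarrow> real"
  assumes "0 < q" "q < 1"
    and step: "\<And>k. \<bar>F k - F (Suc k)\<bar> \<le> L * (q ^ k - q ^ Suc k)"
  shows "\<bar>F m - F k\<bar> \<le> L * \<bar>q ^ k - q ^ m\<bar>"
proof -
  have le: "\<bar>F i - F (i + d)\<bar> \<le> L * (q ^ i - q ^ (i + d))" for i d
  proof (induction d)
    case (Suc d)
    with step[of "i + d"] show ?case by (simp add: algebra_simps)
  qed simp
  have mono: "q ^ j \<le> q ^ i" if "i \<le> j" for i j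
    using assms that by (intro power_decreasing) auto
  show ?thesis
  proof (cases "k \<le> m")
    case True
    then show ?thesis using le[of k "m - k"] mono[of k m] by (simp add: abs_minus_commute)
  next
    case False
    then show ?thesis using le[of m "k - m"] mono[of m k] by (simp add: abs_minus_commute)
  qed
qed

text \<open>The weights \<open>(1 - q) * q ^ k\<close> sum to 1, so the deviation is the weighted
  series of \<open>F m - F k\<close>. It is dominated termwise by a convergent series with known
  sum.\<close>

lemma q_mean_deviation_le:
  fixes F :: "nat \<Rightarrow> real"
  assumes q: "0 < q" "q < 1"
    and summ: "summable (\<lambda>k. q ^ k * F k)"
    and step: "\<And>k. \<bar>F k - F (Suc k)\<bar> \<le> L * (q ^ k - q ^ Suc k)"
  shows "\<bar>F m - (1 - q) * (\<Sum>k. q ^ k * F k)\<bar>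
    \<le> L * ((1 + 2 * q ^ (2 * m + 1)) / (1 + q) - q ^ m)"
proof -
  let ?g = "\<lambda>k. (1 - q) * q ^ k * (F m - F k)"
  let ?h = "\<lambda>k. L * ((1 - q) * q ^ k * \<bar>q ^ k - q ^ m\<bar>)"
  have "(\<lambda>k. (1 - q) * F m * q ^ k - (1 - q) * (q ^ k * F k)) sums
      ((1 - q) * F m * (1 / (1 - q)) - (1 - q) * (\<Sum>k. q ^ k * F k))"
    using q by (intro sums_diff sums_mult geometric_sums summable_sums summ) auto
  moreover have "(1 - q) * F m * (1 / (1 - q)) = F m" using q by simp
  moreover have "(\<lambda>k. (1 - q) * F m * q ^ k - (1 - q) * (q ^ k * F k)) = ?g"
    by (simp add: algebra_simps)
  ultimately have g: "?g sums (F m - (1 - q) * (\<Sum>k. q ^ k * F k))" by simp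
  have h: "?h sums (L * ((1 + 2 * q ^ (2 * m + 1)) / (1 + q) - q ^ m))"
    by (intro sums_mult sums_abs_diff_power q)
  have gh: "norm (?g k) \<le> ?h k" for k
    using mult_left_mono[OF abs_diff_le_power_diff[OF q step, of m k], of "(1 - q) * q ^ k"] q
    by (simp add: abs_mult mult_ac)
  have "norm (suminf ?g) \<le> suminf ?h"
    using gh by (intro norm_suminf_le sums_summable[OF h])
  then show ?thesis
    using sums_unique[OF g] sums_unique[OF h] by simp
qed

text \<open>The constant is the sum of a series of nonnegative terms whose term at index
  \<open>Suc m\<close> is positive. Strict positivity serves the case of an infinite norm.\<close>

lemma q_mean_coefficient_pos:
  fixes q :: real
  assumes "0 < q" "q < 1"
  shows "0 < (1 + 2 * q ^ (2 * m + 1)) / (1 + q) - q ^ m"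
proof -
  let ?h = "\<lambda>k. (1 - q) * q ^ k * \<bar>q ^ k - q ^ m\<bar>"
  have h: "?h sums ((1 + 2 * q ^ (2 * m + 1)) / (1 + q) - q ^ m)"
    using assms by (rule sums_abs_diff_power)
  have "q ^ Suc m < q ^ m" using assms by simp
  then have "0 < ?h (Suc m)" using assms by (intro mult_pos_pos) auto
  then have "0 < suminf ?h"
    using assms by (intro suminf_pos2[OF sums_summable[OF h], of "Suc m"]) auto
  then show ?thesis using sums_unique[OF h] by simp
qed

theorem corollary13:
  fixes a b q :: real and f :: "real \<Rightarrow> real"
  assumes "a < b" and "0 < q" and "q < 1"
    and "q_integrable q a b f"
  shows "ereal \<bar>f (a + q powi \<lfloor>log q (1/2)\<rfloor> * (b - a)) - 1 / (b - a) * q_integral q a b f\<bar>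
    \<le> ereal ((b - a) * ((1 + 2 * q powi (2 * \<lfloor>log q (1/2)\<rfloor> + 1)) / (1 + q) - q powi \<lfloor>log q (1/2)\<rfloor>))
      * sup_norm_on {a<..b} (q_deriv q a f)"
proof -
  define m where "m = nat \<lfloor>log q (1/2)\<rfloor>"
  \<comment> \<open>Both \<open>ln (1/2)\<close> and \<open>ln q\<close> are negative. Hence the
    floor is a natural number and \<open>powi\<close> becomes an ordinary power.\<close>
  have "0 \<le> log q (1/2)"
    using assms by (auto simp: log_def divide_nonpos_neg)
  then have fl: "\<lfloor>log q (1/2)\<rfloor> = int m" by (simp add: m_def)
  have pw: "q powi int m = q ^ m" "q powi (2 * int m + 1) = q ^ (2 * m + 1)"
    using power_int_of_nat[of q m] power_int_of_nat[of q "2 * m + 1"] by (simp_all add: add.commute)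
  let ?c = "(1 + 2 * q ^ (2 * m + 1)) / (1 + q) - q ^ m"
  let ?S = "sup_norm_on {a<..b} (q_deriv q a f)"
  have c: "0 < (b - a) * ?c"
    using assms q_mean_coefficient_pos[of q m] by (intro mult_pos_pos) auto
  have up: "ereal \<bar>q_deriv q a f t\<bar> \<le> ?S" if "t \<in> {a<..b}" for t
    unfolding sup_norm_on_def using that by (rule SUP_upper)
  \<comment> \<open>The point \<open>b\<close> lies in the half-open interval, so the supremum is
    bounded below by a real number.\<close>
  have "?S \<noteq> - \<infinity>" using up[of b] assms by auto
  then consider M where "?S = ereal M" | "?S = \<infinity>" by (cases ?S) auto
  then show ?thesis
  proof cases
    case 1
    define F where "F k = f (a + q ^ k * (b - a))" for k
    \<comment> \<open>The \<open>q\<close>-derivative at the \<open>k\<close>-th node is the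
      difference quotient over nodes \<open>k\<close> and \<open>Suc k\<close>, whose distance is
      \<open>(b - a) * (q ^ k - q ^ Suc k)\<close>.\<close>
    have step: "\<bar>F k - F (Suc k)\<bar> \<le> ((b - a) * M) * (q ^ k - q ^ Suc k)" for k
    proof -
      let ?x = "a + q ^ k * (b - a)"
      have qk: "0 < q ^ k * (b - a)" "q ^ k \<le> 1"
        using assms by (auto intro: power_le_one)
      moreover have "q ^ k * (b - a) \<le> b - a"
        using assms qk by (intro mult_left_le_one_le) auto
      ultimately have "?x \<in> {a<..b}" by simp
      then have "\<bar>q_deriv q a f ?x\<bar> \<le> M" using up[of ?x] 1 by simp
      moreover have "q_deriv q a f ?x = (F k - F (Suc k)) / ((1 - q) * (q ^ k * (b - a)))"
        by (simp add: q_deriv_def F_def mult.assoc)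
      moreover have "0 < (1 - q) * (q ^ k * (b - a))" using assms qk by (intro mult_pos_pos) auto
      ultimately have "\<bar>F k - F (Suc k)\<bar> \<le> M * ((1 - q) * (q ^ k * (b - a)))"
        by (simp add: abs_divide divide_le_eq)
      then show ?thesis by (simp add: algebra_simps)
    qed
    have "summable (\<lambda>k. q ^ k * F k)"
      using assms(4) by (simp add: q_integrable_def F_def)
    from q_mean_deviation_le[OF assms(2,3) this step, of m]
    have "\<bar>f (a + q ^ m * (b - a)) - 1 / (b - a) * q_integral q a b f\<bar> \<le> (b - a) * ?c * M"
      using assms(1) by (simp add: q_integral_def F_def mult_ac)
    then show ?thesis unfolding fl pw 1 by simp
  next
    case 2
    \<comment> \<open>In \<open>ereal\<close> the product of 0 and \<open>\<infinity>\<close> is 0,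
      so the right-hand side is infinite only because the factor is strictly positive.\<close>
    moreover have "ereal r * \<infinity> = \<infinity>" if "0 < r" for r
      using that by simp
    note this[OF c]
    ultimately show ?thesis unfolding fl pw by (simp only: ereal_less_eq)
  qed
qed

end
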